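(* Let $k\ge 1$ and $n\ge 3$ be integers and let $C_n$ be the cycle graph on $n$ vertices. If the vertices of $C_n$ are colored uniformly and independently with $k$ colors, the expected number of blocks is $$\mathbb{E}[X_k(C_n)] = \frac{1}{k^n}\left(k+n(k^n-k^{n-1})\right).$$
   Context: Given a coloring of the vertices of a finite graph $G$ with $k$ colors, the blocks are the connected components of the subgraph of $G$ formed by all vertices and all edges whose two endpoints have the same color. $X_k(G)$ denotes the number of blocks when each vertex of $G$ receives independently a uniformly random color among $k$ colors. *)

theory Defs
  imports "HOL-Probability.Probability" "Graph_Theory.Graph_Theory"
begin

text \<open>
  Following the Graph_Theory library, an undirected simple graph is a finite, loop-free, symmetric
  digraph (\<open>pair_graph\<close>): an edge \<open>{u, v}\<close> is the pair of arcs \<open>(u, v)\<close>, \<open>(v, u)\<close>.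
\<close>

definition cycle_graph :: "nat \<Rightarrow> nat pair_pre_digraph" where
  "cycle_graph n =
     \<lparr>pverts = {..<n},
      parcs = {(u, v). u < n \<and> v < n \<and> (v = Suc u mod n \<or> u = Suc v mod n)}\<rparr>"

definition mono_subgraph :: "'a pair_pre_digraph \<Rightarrow> ('a \<Rightarrow> 'c) \<Rightarrow> 'a pair_pre_digraph" where
  "mono_subgraph G c = \<lparr>pverts = pverts G, parcs = {(u, v) \<in> parcs G. c u = c v}\<rparr>"

text \<open>
  The constant \<open>connected\<close> is qualified because the unqualified name is also that of topological
  connectedness. It requires a nonempty vertex set.
\<close>

definition blocks :: "'a pair_pre_digraph \<Rightarrow> ('a \<Rightarrow> 'c) \<Rightarrow> ('a, 'a \<times> 'a) pre_digraph set" where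
  "blocks G c =
     {H. pre_digraph.max_subgraph (with_proj (mono_subgraph G c)) Digraph_Component.connected H}"

definition num_blocks :: "'a pair_pre_digraph \<Rightarrow> ('a \<Rightarrow> 'c) \<Rightarrow> nat" where
  "num_blocks G c = card (blocks G c)"

text \<open>
  The colors are \<open>0, \<dots>, k - 1\<close>; colorings take the irrelevant default value \<open>0\<close> outside the
  vertex set.
\<close>

definition random_coloring :: "nat \<Rightarrow> 'a pair_pre_digraph \<Rightarrow> ('a \<Rightarrow> nat) pmf" where
  "random_coloring k G = Pi_pmf (pverts G) 0 (\<lambda>_. pmf_of_set {..<k})"

lemma pair_graph_cycle_graph:
  assumes "n \<ge> 3"
  shows "pair_graph (cycle_graph n)"
proof
  show "finite (parcs (cycle_graph n))"
    by (rule finite_subset[of _ "{..<n} \<times> {..<n}"]) (auto simp: cycle_graph_def)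
  show "symmetric (with_proj (cycle_graph n))"
    by (auto simp: symmetric_def cycle_graph_def intro!: symI)
  show "fst e \<noteq> snd e" if "e \<in> parcs (cycle_graph n)" for e
    using that assms by (auto simp: cycle_graph_def mod_Suc split: if_splits)
qed (auto simp: cycle_graph_def)

lemma pair_graph_mono_subgraph:
  assumes "pair_graph G"
  shows "pair_graph (mono_subgraph G c)"
proof -
  interpret pair_graph G by fact
  show ?thesis
  proof
    show "finite (parcs (mono_subgraph G c))"
      by (rule finite_subset[OF _ pair_finite_arcs]) (auto simp: mono_subgraph_def)
    show "symmetric (with_proj (mono_subgraph G c))"
      using pair_sym_arcs by (auto simp: symmetric_def mono_subgraph_def intro!: symI dest: symD)
    show "fst e \<noteq> snd e" if "e \<in> parcs (mono_subgraph G c)" for e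
      using that pair_no_loops by (auto simp: mono_subgraph_def)
  qed (auto simp: mono_subgraph_def dest: in_arcsD1 in_arcsD2)
qed

end

theory Submission
  imports Defs
begin

text \<open>
  Walking forward from any vertex of the cycle, one stays in its block until one meets an edge with
  differently colored ends. So if there are such edges, each block contains exactly one of their
  initial vertices, and the number of blocks is the number of these edges; otherwise there is a
  single block. Each edge has differently colored ends with probability \<open>1 - 1 / k\<close>, and the
  coloring is constant with probability \<open>k / k ^ n\<close>, so the result follows by linearity of
  expectation.
\<close>

section \<open>Maximal connected subgraphs of symmetric digraphs\<close>

lemma (in wf_digraph) strongly_connected_imp_connected:
  assumes "strongly_connected G"
  shows "Digraph_Component.connected G"
  using assms reachable_mk_symmetricI
  by (auto simp: connected_def strongly_connected_def mk_symmetric_def)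

text \<open>Extra arcs on the same vertices cannot disconnect a graph; hence, through
  \<open>induced_subgraphI_arc_mono\<close>, maximal connected subgraphs are induced.\<close>

lemma arc_mono_connected: "arc_mono Digraph_Component.connected"
  unfolding arc_mono_def
proof (intro allI impI, elim conjE)
  fix H1 H2 :: "('a, 'b) pre_digraph"
  assume "Digraph_Component.connected H1" "subgraph H1 H2" "verts H1 = verts H2"
  moreover from this have "wf_digraph H2" by (auto simp: subgraph_def)
  ultimately show "Digraph_Component.connected H2"
    by (intro wf_digraph.connected_spanning_imp_connected[of H2 H1]) (auto simp: spanning_def)
qed

lemma symmetric_induce_subgraph:
  assumes "symmetric G"
  shows "symmetric (G \<restriction> S)"
proof -
  have "arcs_ends (G \<restriction> S) = arcs_ends G \<inter> S \<times> S"
    by (auto simp: arcs_ends_conv)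
  then show ?thesis
    using assms by (auto simp: symmetric_def sym_def)
qed

text \<open>\<open>H\<close> may lack reverse arcs, so it can be connected without being strongly
  connected. The induced subgraph inherits symmetry from \<open>G\<close>, and there the two notions
  agree.\<close>

lemma (in sym_digraph) strongly_connected_induce_verts:
  assumes "subgraph H G" "Digraph_Component.connected H"
  shows "strongly_connected (G \<restriction> verts H)"
proof -
  interpret S: wf_digraph "G \<restriction> verts H"
    by (rule wellformed_induce_subgraph)
  have "Digraph_Component.connected (G \<restriction> verts H)"
    using arc_mono_connected assms subgraph_induce_subgraphI2[OF assms(1)]
    unfolding arc_mono_def by (metis induce_subgraph_verts)
  then show ?thesis
    using S.symmetric_connected_imp_strongly_connected symmetric_induce_subgraph sym_arcs by blast
qed

text \<open>Turns blocks into strongly connected components, whose vertex sets \<open>scc_of\<close>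
  are described by reachability alone.\<close>

lemma (in sym_digraph) max_subgraph_connected_iff:
  "max_subgraph Digraph_Component.connected H \<longleftrightarrow> max_subgraph strongly_connected H"
proof
  assume H: "max_subgraph Digraph_Component.connected H"
  have "induced_subgraph H G"
    using H arc_mono_connected by (rule induced_subgraphI_arc_mono)
  then have "H = G \<restriction> verts H"
    by (metis induce_eq_iff_induced)
  moreover have "strongly_connected (G \<restriction> verts H)"
    using H by (intro strongly_connected_induce_verts) (auto simp: max_subgraph_def)
  ultimately have sc: "strongly_connected H"
    by simp
  show "max_subgraph strongly_connected H"
    unfolding max_subgraph_def
  proof (intro conjI allI impI notI sc subgraphI_max_subgraph[OF H])
    fix H' assume "H' \<noteq> H \<and> subgraph H H'" "subgraph H' G \<and> strongly_connected H'"
    then show False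
      using H wf_digraph.strongly_connected_imp_connected[of H']
      by (auto simp: max_subgraph_def subgraph_def)
  qed
next
  assume H: "max_subgraph strongly_connected H"
  have sub: "subgraph H G" and "strongly_connected H"
    using H by (auto simp: max_subgraph_def)
  then have conn: "Digraph_Component.connected H"
    by (intro wf_digraph.strongly_connected_imp_connected) (auto simp: subgraph_def)
  show "max_subgraph Digraph_Component.connected H"
    unfolding max_subgraph_def
  proof (intro conjI allI impI notI sub conn)
    fix K assume "K \<noteq> H \<and> subgraph H K" "subgraph K G \<and> Digraph_Component.connected K"
    then have K: "K \<noteq> H" "subgraph H K" "subgraph K G" "Digraph_Component.connected K"
      by auto
    \<comment> \<open>\<open>K\<close> need not be symmetric, so maximality of \<open>H\<close> is
      applied to the induced subgraph on \<open>verts K\<close>. It equals \<open>H\<close>, which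
      squeezes \<open>K\<close> between \<open>H\<close> and itself.\<close>
    have KG: "subgraph K (G \<restriction> verts K)"
      by (rule subgraph_induce_subgraphI2) fact
    have "subgraph (G \<restriction> verts K) G"
      using K by (intro subgraph_induce_subgraphI) auto
    moreover have "strongly_connected (G \<restriction> verts K)"
      using K by (intro strongly_connected_induce_verts)
    moreover have "subgraph H (G \<restriction> verts K)"
      using K KG by (blast intro: subgraph_trans)
    ultimately have "G \<restriction> verts K = H"
      using H unfolding max_subgraph_def by blast
    with KG K show False
      by (metis subgraph_def pre_digraph.equality compatible_def subset_antisym unit_eq)
  qed
qed

lemma num_blocks_eq_card_scc_of:
  assumes "pair_graph G"
  shows "num_blocks G c =
    card (pre_digraph.scc_of (with_proj (mono_subgraph G c)) ` pverts G)"
proof -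
  interpret M: pair_graph "mono_subgraph G c"
    using assms by (rule pair_graph_mono_subgraph)
  have "num_blocks G c = card M.sccs"
    by (simp add: num_blocks_def blocks_def M.max_subgraph_connected_iff M.sccs_altdef2)
  also have "\<dots> = card M.sccs_verts"
    by (rule M.card_sccs_verts[symmetric])
  also have "\<dots> = card (M.scc_of ` pverts G)"
    by (subst M.sccs_verts_conv_scc_of) (simp add: mono_subgraph_def)
  finally show ?thesis .
qed

section \<open>Blocks of a colored cycle\<close>

text \<open>An edge is represented by its initial vertex in the cyclic orientation, so that breaks
  can also serve as representatives of blocks.\<close>

definition color_breaks :: "nat \<Rightarrow> (nat \<Rightarrow> 'c) \<Rightarrow> nat set" where
  "color_breaks n c = {u. u < n \<and> c u \<noteq> c (Suc u mod n)}"

lemma finite_color_breaks [simp]: "finite (color_breaks n c)"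
  by (simp add: color_breaks_def)

context
  fixes n :: nat and c :: "nat \<Rightarrow> 'c" and M
  assumes n: "n \<ge> 3"
  defines "M \<equiv> with_proj (mono_subgraph (cycle_graph n) c)"
begin

interpretation M: sym_digraph M
proof -
  interpret pair_graph "mono_subgraph (cycle_graph n) c"
    using n by (intro pair_graph_mono_subgraph pair_graph_cycle_graph)
  show "sym_digraph M" unfolding M_def by unfold_locales
qed

lemma mono_cycle_adj_iff:
  "u \<rightarrow>\<^bsub>M\<^esub> v \<longleftrightarrow> u < n \<and> v < n \<and> (v = Suc u mod n \<or> u = Suc v mod n) \<and> c u = c v"
  by (auto simp: M_def mono_subgraph_def cycle_graph_def)

lemma verts_mono_cycle: "verts M = {..<n}"
  by (simp add: M_def mono_subgraph_def cycle_graph_def)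

text \<open>Induction on the number \<open>j\<close> of forward steps: the walk extends unless its
  current end is a break, and then a break has been reached.\<close>

lemma reachable_forward_or_break:
  assumes "v < n"
  shows "(\<exists>u \<in> color_breaks n c. v \<rightarrow>\<^sup>*\<^bsub>M\<^esub> u) \<or> v \<rightarrow>\<^sup>*\<^bsub>M\<^esub> ((v + j) mod n)"
proof (induction j)
  case 0
  have "v \<rightarrow>\<^sup>*\<^bsub>M\<^esub> v"
    using assms by (simp add: verts_mono_cycle)
  then show ?case using assms by simp
next
  case (Suc j)
  let ?w = "(v + j) mod n"
  show ?case
  proof (cases "(\<exists>u \<in> color_breaks n c. v \<rightarrow>\<^sup>*\<^bsub>M\<^esub> u) \<or> ?w \<in> color_breaks n c")
    case True
    then show ?thesis using Suc by blast
  next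
    case False
    then have "v \<rightarrow>\<^sup>*\<^bsub>M\<^esub> ?w" using Suc by blast
    moreover have "?w \<rightarrow>\<^bsub>M\<^esub> ((v + Suc j) mod n)"
      using False n by (auto simp: mono_cycle_adj_iff color_breaks_def mod_Suc_eq)
    ultimately have "v \<rightarrow>\<^sup>*\<^bsub>M\<^esub> ((v + Suc j) mod n)"
      by (rule M.reachable_adj_trans)
    then show ?thesis ..
  qed
qed

lemma reachable_mono_cycle_if_no_breaks:
  assumes "v < n" "w < n" "color_breaks n c = {}"
  shows "v \<rightarrow>\<^sup>*\<^bsub>M\<^esub> w"
  \<comment> \<open>\<open>n - v + w\<close> forward steps lead from \<open>v\<close> to
    \<open>w\<close> modulo \<open>n\<close>; the summand \<open>n\<close> avoids truncated
    subtraction when \<open>w < v\<close>.\<close>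
  using reachable_forward_or_break[OF assms(1), of "n - v + w"] assms by auto

text \<open>If the walk is aimed at a break \<open>b\<close>, both alternatives of
  \<open>reachable_forward_or_break\<close> end at a break.\<close>

lemma reaches_color_break:
  assumes "v < n" "color_breaks n c \<noteq> {}"
  shows "\<exists>u \<in> color_breaks n c. v \<rightarrow>\<^sup>*\<^bsub>M\<^esub> u"
proof -
  obtain b where b: "b \<in> color_breaks n c" using assms by auto
  then have "(v + (n - v + b)) mod n = b"
    using assms by (simp add: color_breaks_def)
  then show ?thesis
    using reachable_forward_or_break[OF assms(1), of "n - v + b"] b by auto
qed

text \<open>No monochromatic edge leaves the arc of the cycle strictly after one break up to the next.\<close>

lemma color_breaks_not_reachable:
  assumes "u \<in> color_breaks n c" "w \<in> color_breaks n c" "u < w"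
  shows "\<not> w \<rightarrow>\<^sup>*\<^bsub>M\<^esub> u"
proof
  have "v \<in> {u<..w}" if "w \<rightarrow>\<^sup>*\<^bsub>M\<^esub> v" for v
    using that
  proof (induction rule: M.reachable_induct)
    case base
    show ?case using assms by simp
  next
    case (step x y)
    \<comment> \<open>A step back from \<open>Suc u\<close> to \<open>u\<close> would cross the
      break at \<open>u\<close>; a step forward from \<open>w\<close>, possibly wrapping around to
      \<open>0\<close>, would cross the break at \<open>w\<close>.\<close>
    then show ?case
      using assms n
      by (cases "x = w") (auto simp: mono_cycle_adj_iff color_breaks_def mod_Suc less_Suc_eq
          split: if_splits)
  qed
  moreover assume "w \<rightarrow>\<^sup>*\<^bsub>M\<^esub> u"
  ultimately show False by force
qed

lemma num_blocks_cycle_graph: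
  "num_blocks (cycle_graph n) c =
     card (color_breaks n c) + (if color_breaks n c = {} then 1 else 0)"
proof -
  have num: "num_blocks (cycle_graph n) c = card (M.scc_of ` {..<n})"
    using num_blocks_eq_card_scc_of[OF pair_graph_cycle_graph[OF n], of c]
    by (simp add: cycle_graph_def M_def)
  \<comment> \<open>One direction suffices, since reachability in \<open>M\<close> is
    symmetric.\<close>
  have scc_eq: "M.scc_of v = M.scc_of w" if "v \<rightarrow>\<^sup>*\<^bsub>M\<^esub> w" for v w
    using that M.scc_of_eq M.scc_ofI_reachable by blast
  show ?thesis
  proof (cases "color_breaks n c = {}")
    case True
    have "0 < n" using n by simp
    then have "M.scc_of v = M.scc_of 0" if "v < n" for v
      using that True by (intro scc_eq reachable_mono_cycle_if_no_breaks)
    with \<open>0 < n\<close> have "M.scc_of ` {..<n} = {M.scc_of 0}"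
      by (metis image_constant_conv image_cong lessThan_iff empty_iff)
    then show ?thesis using num True by simp
  next
    case False
    have "M.scc_of ` {..<n} = M.scc_of ` color_breaks n c"
    proof
      show "M.scc_of ` {..<n} \<subseteq> M.scc_of ` color_breaks n c"
      proof (rule image_subsetI)
        fix v assume "v \<in> {..<n}"
        then obtain u where "u \<in> color_breaks n c" "v \<rightarrow>\<^sup>*\<^bsub>M\<^esub> u"
          using reaches_color_break[OF _ False] by auto
        then show "M.scc_of v \<in> M.scc_of ` color_breaks n c"
          by (simp add: scc_eq)
      qed
      show "M.scc_of ` color_breaks n c \<subseteq> M.scc_of ` {..<n}"
        by (auto simp: color_breaks_def)
    qed
    moreover have "inj_on M.scc_of (color_breaks n c)"
    proof (rule inj_onI)
      fix u w assume uw: "u \<in> color_breaks n c" "w \<in> color_breaks n c" "M.scc_of u = M.scc_of w"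
      then have "u \<in> M.scc_of w"
        using M.in_scc_of_self[of u] verts_mono_cycle by (auto simp: color_breaks_def)
      then have "u \<rightarrow>\<^sup>*\<^bsub>M\<^esub> w" "w \<rightarrow>\<^sup>*\<^bsub>M\<^esub> u"
        by (auto simp: M.scc_of_def)
      then show "u = w"
        using color_breaks_not_reachable uw by (meson linorder_neqE_nat)
    qed
    ultimately show ?thesis
      using num False by (simp add: card_image)
  qed
qed

end

text \<open>Induction along the path carries the color of \<open>0\<close> to every vertex. This
  puts the exceptional case in the form of a monochromatic event.\<close>

lemma color_breaks_empty_iff:
  assumes "n > 0"
  shows "color_breaks n c = {} \<longleftrightarrow> (\<exists>i. \<forall>u<n. c u = i)"
proof
  assume empty: "color_breaks n c = {}"
  have "u < n \<Longrightarrow> c u = c 0" for u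
  proof (induction u)
    case (Suc u)
    then have "u \<notin> color_breaks n c" using empty by simp
    with Suc show ?case by (simp add: color_breaks_def)
  qed simp
  then show "\<exists>i. \<forall>u<n. c u = i" by blast
next
  assume "\<exists>i. \<forall>u<n. c u = i"
  then show "color_breaks n c = {}"
    using assms by (auto simp: color_breaks_def)
qed

section \<open>Monochromatic sets in random colorings\<close>

text \<open>Split by the common color: by independence each of the \<open>k\<close> colors
  contributes \<open>1 / k ^ card S\<close>. Taking for \<open>S\<close> the ends of an edge or the
  whole vertex set covers both kinds of event in the expectation.\<close>

lemma prob_Pi_pmf_monochromatic:
  assumes "finite A" "S \<subseteq> A" "S \<noteq> {}" "k \<ge> 1"
  shows "measure_pmf.prob (Pi_pmf A d (\<lambda>_. pmf_of_set {..<k})) {c. \<exists>i. \<forall>x\<in>S. c x = i} =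
    real k / real k ^ card S"
proof -
  let ?p = "Pi_pmf A d (\<lambda>_. pmf_of_set {..<k})"
  \<comment> \<open>A product of sets, unrestricted off \<open>S\<close>, is the form to which
    \<open>measure_Pi_pmf_Pi\<close> applies.\<close>
  let ?E = "\<lambda>i::nat. Pi A (\<lambda>x. if x \<in> S then {i} else UNIV)"
  have E: "?E i = {c. \<forall>x\<in>S. c x = i}" for i
    using assms(2) by (auto simp: Pi_def)
  have color: "c x < k" if "c \<in> set_pmf ?p" "x \<in> A" for c x
    using that assms by (auto simp: set_Pi_pmf PiE_dflt_def lessThan_empty_iff)
  have prob_E: "measure_pmf.prob ?p (?E i) = 1 / real k ^ card S" if "i < k" for i
  proof -
    have "measure_pmf.prob ?p (?E i) =
        (\<Prod>x\<in>A. measure_pmf.prob (pmf_of_set {..<k}) (if x \<in> S then {i} else UNIV))"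
      using assms(1) by (rule measure_Pi_pmf_Pi)
    also have "\<dots> = (\<Prod>x\<in>A. if x \<in> S then 1 / real k else 1)"
      using that assms(4)
      by (intro prod.cong) (auto simp: measure_pmf_of_set lessThan_empty_iff)
    also have "\<dots> = (1 / real k) ^ card S"
      using assms by (simp add: prod.If_cases Int_absorb1)
    finally show ?thesis by (simp add: power_one_over)
  qed
  \<comment> \<open>The events agree only almost surely: on the left \<open>i\<close> is any natural
    number, and the color of a point of \<open>S\<close> lies below \<open>k\<close> only on the
    support.\<close>
  have "measure_pmf.prob ?p {c. \<exists>i. \<forall>x\<in>S. c x = i} = measure_pmf.prob ?p (\<Union>i<k. ?E i)"
  proof (rule measure_pmf.finite_measure_eq_AE)
    obtain x where "x \<in> S" using assms(3) by blast
    then have "(\<exists>i. \<forall>x\<in>S. c x = i) \<longleftrightarrow> (\<exists>i<k. \<forall>x\<in>S. c x = i)" if "c \<in> set_pmf ?p" for c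
      using color[OF that, of x] assms(2) by (metis subsetD)
    then show "AE c in ?p. (c \<in> {c. \<exists>i. \<forall>x\<in>S. c x = i}) = (c \<in> (\<Union>i<k. ?E i))"
      unfolding E AE_measure_pmf_iff by auto
  qed auto
  also have "\<dots> = (\<Sum>i<k. measure_pmf.prob ?p (?E i))"
    \<comment> \<open>On the nonempty set \<open>S\<close> a coloring cannot be constant with two
      different values, so the events are disjoint.\<close>
    using assms(3) by (intro measure_pmf.finite_measure_finite_Union) (auto simp: disjoint_family_on_def E)
  also have "\<dots> = real k / real k ^ card S"
    by (simp add: prob_E)
  finally show ?thesis .
qed

theorem corollary3p2:
  fixes k n :: nat
  assumes "k \<ge> 1" and "n \<ge> 3"
  shows "measure_pmf.expectation (random_coloring k (cycle_graph n))
           (\<lambda>c. real (num_blocks (cycle_graph n) c)) =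
         1 / real k ^ n * (real k + real n * (real k ^ n - real k ^ (n - 1)))"
proof -
  let ?p = "Pi_pmf {..<n} 0 (\<lambda>_. pmf_of_set {..<k})"
  let ?mono = "\<lambda>S. {c :: nat \<Rightarrow> nat. \<exists>i. \<forall>x\<in>S. c x = i}"
  let ?e = "\<lambda>u. {u, Suc u mod n}"
  have rc: "random_coloring k (cycle_graph n) = ?p"
    by (simp add: random_coloring_def cycle_graph_def)
  \<comment> \<open>Edges are not loops, which gives the exponent 2 in the break probability
    \<open>1 - k / k ^ 2\<close>.\<close>
  have card_e: "card (?e u) = 2" if "u < n" for u
    using that assms(2) by (auto simp: mod_Suc card_insert_if)
  \<comment> \<open>A sum of indicators prepares linearity of expectation; the last one accounts for
    the single block of a constant coloring.\<close>
  have blocks: "real (num_blocks (cycle_graph n) c) =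
      (\<Sum>u<n. 1 - indicator (?mono (?e u)) c) + indicator (?mono {..<n}) c" for c
  proof -
    have "real (card (color_breaks n c)) = (\<Sum>u<n. if c u \<noteq> c (Suc u mod n) then 1 else 0)"
      by (simp add: color_breaks_def sum.If_cases Int_def)
    also have "\<dots> = (\<Sum>u<n. 1 - indicator (?mono (?e u)) c)"
      by (intro sum.cong) (auto simp: indicator_def)
    finally show ?thesis
      using num_blocks_cycle_graph[OF assms(2), of c] color_breaks_empty_iff[of n c] assms(2)
      by (auto simp: indicator_def)
  qed
  have int: "integrable ?p (indicator B :: _ \<Rightarrow> real)" for B
    by (intro integrable_real_indicator) (auto simp: measure_pmf.emeasure_eq_measure)
  have "measure_pmf.expectation ?p (\<lambda>c. real (num_blocks (cycle_graph n) c)) =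
      (\<Sum>u<n. 1 - measure_pmf.prob ?p (?mono (?e u))) + measure_pmf.prob ?p (?mono {..<n})"
    unfolding blocks using int by (simp add: integral_sum)
  also have "\<dots> = (\<Sum>u<n. 1 - real k / real k ^ 2) + real k / real k ^ n"
  proof -
    have "measure_pmf.prob ?p (?mono (?e u)) = real k / real k ^ 2" if "u < n" for u
      using prob_Pi_pmf_monochromatic[of "{..<n}" "?e u" k 0] card_e[OF that] that assms by simp
    moreover have "measure_pmf.prob ?p (?mono {..<n}) = real k / real k ^ n"
      using prob_Pi_pmf_monochromatic[of "{..<n}" "{..<n}" k 0] assms
      by (simp add: lessThan_empty_iff)
    ultimately show ?thesis by simp
  qed
  also have "\<dots> = 1 / real k ^ n * (real k + real n * (real k ^ n - real k ^ (n - 1)))"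
  proof -
    \<comment> \<open>This turns \<open>k ^ (n - 1)\<close> into \<open>k ^ m\<close>, so that the
      identity becomes field arithmetic.\<close>
    obtain m where "n = Suc m" using assms(2) by (cases n) auto
    then show ?thesis
      using assms(1) by (simp add: field_simps power2_eq_square)
  qed
  finally show ?thesis by (simp only: rc)
qed

end
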